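(* Let $\mu_0,\mu_1$ be as in the context. For all $\varepsilon>0$, the function $f_\varepsilon$ is convex on $\Omega_0$. Moreover, $f_\varepsilon\in\mathcal{C}^1(\Omega_0)$ with derivative $$f_\varepsilon'(x)=\frac{\int_{\mathcal{S}_{x,\varepsilon}}y\,d\mu_1(y)}{\mu_1(\mathcal{S}_{x,\varepsilon})}\in\operatorname{int}\mathcal{S}_{x,\varepsilon}\quad\text{for all }x\in\Omega_0,$$ where $\operatorname{int}$ denotes the interior.
   Context: Standing assumption: for $i=0,1$, $\mu_i$ is a probability measure on $\mathbb{R}$ supported on a compact interval $\Omega_i=[a_i,b_i]$, with a continuous density $u_i\in\mathcal{C}(\Omega_i)$ (i.e. $d\mu_i=u_i\,dx$) satisfying $0<\lambda\le u_i\le\Lambda<\infty$ on $\Omega_i$ for constants $\lambda,\Lambda$. For $\varepsilon>0$, let $\pi_\varepsilon$ be the unique minimizer over couplings $\pi\in\Pi(\mu_0,\mu_1)$ of $\int\frac12(x-y)^2\,d\pi+\frac{\varepsilon}{2}\int\big(\frac{d\pi}{d(\mu_0\otimes\mu_1)}\big)^2d(\mu_0\otimes\mu_1)$. The potentials $(f_\varepsilon,g_\varepsilon)$ are continuous functions $f_\varepsilon:\Omega_0\to\mathbb{R}$, $g_\varepsilon:\Omega_1\to\mathbb{R}$ with $\frac{d\pi_\varepsilon}{d(\mu_0\otimes\mu_1)}(x,y)=\big(\frac{xy-f_\varepsilon(x)-g_\varepsilon(y)}{\varepsilon}\big)_+$, where $(a)_+=\max(a,0)$; equivalently they satisfy $\int(xy-f_\varepsilon(x)-g_\varepsilon(y))_+\,d\mu_1(y)=\varepsilon$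 for all $x\in\Omega_0$ and $\int(xy-f_\varepsilon(x)-g_\varepsilon(y))_+\,d\mu_0(x)=\varepsilon$ for all $y\in\Omega_1$. They exist and are unique up to replacing $(f_\varepsilon,g_\varepsilon)$ by $(f_\varepsilon+\alpha,g_\varepsilon-\alpha)$, $\alpha\in\mathbb{R}$. The $x$-section of the support is $\mathcal{S}_{x,\varepsilon}:=\{y\in\Omega_1:\ xy-f_\varepsilon(x)-g_\varepsilon(y)\ge0\}$; one has $\mu_1(\mathcal{S}_{x,\varepsilon})>0$ for every $x\in\Omega_0$. At endpoints of $\Omega_0$ derivatives are one-sided. *)

theory Defs
  imports "HOL-Probability.Probability"
begin

text \<open>
  A probability measure on the real line supported on \<open>[a, b]\<close> with a continuous density \<open>u\<close>
  satisfying \<open>l \<le> u \<le> L\<close> there. Values of \<open>u\<close> outside \<open>[a, b]\<close> are irrelevant, and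
  \<open>a < b\<close> follows because \<open>\<mu>\<close> has total mass one.
\<close>
definition regular_marginal ::
    "real measure \<Rightarrow> real \<Rightarrow> real \<Rightarrow> (real \<Rightarrow> real) \<Rightarrow> real \<Rightarrow> real \<Rightarrow> bool" where
  "regular_marginal \<mu> a b u l L \<longleftrightarrow>
     prob_space \<mu> \<and>
     \<mu> = density lborel (\<lambda>x. ennreal (indicator {a..b} x * u x)) \<and>
     continuous_on {a..b} u \<and>
     0 < l \<and> (\<forall>x\<in>{a..b}. l \<le> u x \<and> u x \<le> L)"

definition couplings :: "'a measure \<Rightarrow> 'b measure \<Rightarrow> ('a \<times> 'b) measure set" where
  "couplings M N = {\<pi>. sets \<pi> = sets (M \<Otimes>\<^sub>M N) \<and> distr \<pi> M fst = M \<and> distr \<pi> N snd = N}"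

text \<open>
  The regularized cost has the value \<open>\<infinity>\<close> on couplings that are not absolutely continuous
  with respect to the product measure.
\<close>
definition qot_cost ::
    "real measure \<Rightarrow> real measure \<Rightarrow> real \<Rightarrow> (real \<times> real) measure \<Rightarrow> ennreal" where
  "qot_cost \<mu>0 \<mu>1 \<epsilon> \<pi> =
     (if absolutely_continuous (\<mu>0 \<Otimes>\<^sub>M \<mu>1) \<pi>
      then (\<integral>\<^sup>+(x, y). ennreal ((x - y)\<^sup>2 / 2) \<partial>\<pi>)
         + ennreal (\<epsilon> / 2) * (\<integral>\<^sup>+z. (RN_deriv (\<mu>0 \<Otimes>\<^sub>M \<mu>1) \<pi> z)\<^sup>2 \<partial>(\<mu>0 \<Otimes>\<^sub>M \<mu>1))
      else \<infinity>)"

definition qot_minimizer ::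
    "real measure \<Rightarrow> real measure \<Rightarrow> real \<Rightarrow> (real \<times> real) measure \<Rightarrow> bool" where
  "qot_minimizer \<mu>0 \<mu>1 \<epsilon> \<pi> \<longleftrightarrow>
     \<pi> \<in> couplings \<mu>0 \<mu>1 \<and>
     (\<forall>\<pi>'\<in>couplings \<mu>0 \<mu>1. qot_cost \<mu>0 \<mu>1 \<epsilon> \<pi> \<le> qot_cost \<mu>0 \<mu>1 \<epsilon> \<pi>')"

text \<open>
  Potentials of the plan \<open>\<pi>\<close> on \<open>\<Omega>0 \<times> \<Omega>1\<close>. Only the values of \<open>f\<close> on \<open>\<Omega>0\<close> and of \<open>g\<close> on
  \<open>\<Omega>1\<close> matter; the density identity is an identity of Radon-Nikodym derivatives and hence
  holds almost everywhere.
\<close>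
definition qot_potentials ::
    "real measure \<Rightarrow> real measure \<Rightarrow> real set \<Rightarrow> real set \<Rightarrow> real \<Rightarrow> (real \<times> real) measure \<Rightarrow>
     (real \<Rightarrow> real) \<Rightarrow> (real \<Rightarrow> real) \<Rightarrow> bool" where
  "qot_potentials \<mu>0 \<mu>1 \<Omega>0 \<Omega>1 \<epsilon> \<pi> f g \<longleftrightarrow>
     continuous_on \<Omega>0 f \<and> continuous_on \<Omega>1 g \<and>
     absolutely_continuous (\<mu>0 \<Otimes>\<^sub>M \<mu>1) \<pi> \<and>
     (AE (x, y) in \<mu>0 \<Otimes>\<^sub>M \<mu>1.
        RN_deriv (\<mu>0 \<Otimes>\<^sub>M \<mu>1) \<pi> (x, y) = ennreal (max ((x * y - f x - g y) / \<epsilon>) 0))"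

definition support_section ::
    "real set \<Rightarrow> (real \<Rightarrow> real) \<Rightarrow> (real \<Rightarrow> real) \<Rightarrow> real \<Rightarrow> real set" where
  "support_section \<Omega>1 f g x = {y \<in> \<Omega>1. x * y - f x - g y \<ge> 0}"

text \<open>
  Unlike the library's \<open>C1_differentiable_on\<close>, derivatives are taken within \<open>S\<close>, hence are
  one-sided at the endpoints of a compact interval.
\<close>
definition C1_within :: "real set \<Rightarrow> (real \<Rightarrow> real) \<Rightarrow> bool" where
  "C1_within S f \<longleftrightarrow>
     (\<exists>f'. (\<forall>x\<in>S. (f has_real_derivative f' x) (at x within S)) \<and> continuous_on S f')"

end

theory Submission
  imports Defs
begin

text \<open>
  Write \<open>p x y = x y - f x - g y\<close>. The marginal constraints on the plan say that the
  integral of \<open>max (p x y) 0\<close> over \<open>y\<close> against \<open>\<mu>1\<close> equals \<open>\<epsilon>\<close> for \<open>\<mu>0\<close>-almost every \<open>x\<close>,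
  and symmetrically in \<open>y\<close>. Both sides are continuous and the marginals have full support
  on their intervals, so the identities hold at every point
  (\<open>potentials_section_equations\<close>).

  Everything else comes from one inequality. The positive part is convex, and at \<open>t\<close> the
  number \<open>1\<close> (if \<open>t \<ge> 0\<close>) or \<open>0\<close> (otherwise) is a subgradient of it, so
  \<open>max (p x' y) 0 - max (p x y) 0 \<ge> p x' y - p x y = (x' - x) y - (f x' - f x)\<close> for \<open>y\<close> in
  the section \<open>S x\<close>, while the left side is nonnegative for \<open>y\<close> outside it. Integrated over
  \<open>y\<close>, the left side vanishes, because the constraint has the same value \<open>\<epsilon>\<close> at \<open>x\<close> and
  \<open>x'\<close>. Dividing by the mass of \<open>S x\<close> shows that the mean of the section is a subgradient
  of \<open>f\<close> at \<open>x\<close> (\<open>subgradient\<close>). A function with a subgradient at every point is convex.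

  By symmetry \<open>g\<close> is convex too. Hence \<open>p x\<close> is concave, its superlevel set \<open>S x\<close> is
  an interval, and \<open>p x\<close> vanishes at most at the two endpoints (\<open>section_interval\<close>). As
  \<open>\<mu>1\<close> has no atoms, the mean lies strictly between the endpoints, and dominated convergence
  makes it depend continuously on \<open>x\<close>. A continuous selection of subgradients is the
  derivative (\<open>potential_has_derivative\<close>).
\<close>

section \<open>Continuous functions against a finite Borel measure\<close>

lemma set_integrable_continuous_on_compact:
  fixes h :: "real \<Rightarrow> real"
  assumes "finite_measure M" "sets M = sets borel" "compact K" "continuous_on K h"
  shows "set_integrable M K h"
proof -
  interpret finite_measure M by fact
  note assms(2)[measurable_cong]
  have "K \<in> sets borel"
    using assms(3) by (simp add: borel_closed compact_imp_closed)
  then have "(\<lambda>y. indicator K y *\<^sub>R h y) \<in> borel_measurable borel"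
    using assms(4) by (rule borel_measurable_continuous_on_indicator)
  then have meas: "(\<lambda>y. indicator K y *\<^sub>R h y) \<in> borel_measurable M"
    by simp
  obtain B where "0 < B" and B: "\<And>y. y \<in> K \<Longrightarrow> norm (h y) \<le> B"
    using compact_imp_bounded[OF compact_continuous_image[OF assms(4,3)]]
    by (auto simp: bounded_pos)
  have "norm (indicator K y *\<^sub>R h y) \<le> B" for y
    using B \<open>0 < B\<close> by (auto simp: indicator_def)
  then show ?thesis
    unfolding set_integrable_def using meas by (intro integrable_const_bound[of _ B]) auto
qed

section \<open>The section equation\<close>

text \<open>
  The constraint at every point of \<open>X\<close>, stated for one marginal only: it applies to \<open>f\<close>
  with \<open>M = \<mu>1\<close> and, with the potentials exchanged, to \<open>g\<close> with \<open>M = \<mu>0\<close>.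
\<close>
locale section_equation = finite_measure M
  for M :: "real measure" +
  fixes X :: "real set" and a b \<epsilon> :: real and f g :: "real \<Rightarrow> real"
  assumes sets_M [measurable_cong]: "sets M = sets borel"
    and convex_X: "convex X"
    and cont_g: "continuous_on {a..b} g"
    and eps_pos: "0 < \<epsilon>"
    and section_integral:
      "\<And>x. x \<in> X \<Longrightarrow> (LINT y:{a..b}|M. max (x * y - f x - g y) 0) = \<epsilon>"
begin

abbreviation "S \<equiv> support_section {a..b} f g"

definition "section_mean x = (LINT y:S x|M. y) / measure M (S x)"

lemma compact_section: "compact (S x)"
proof -
  have "S x = {a..b} \<inter> (\<lambda>y. x * y - f x - g y) -` {0..}"
    by (auto simp: support_section_def)
  also have "closed \<dots>"
    by (intro continuous_closed_preimage continuous_intros cont_g)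
  finally have "closed (S x)" .
  moreover have "S x \<subseteq> {a..b}" by (auto simp: support_section_def)
  ultimately show ?thesis
    by (meson bounded_closed_interval bounded_subset compact_eq_bounded_closed)
qed

lemma section_sets [measurable]: "S x \<in> sets M"
  using compact_section by (simp add: sets_M borel_closed compact_imp_closed)

lemma integrable_section:
  fixes h :: "real \<Rightarrow> real"
  shows "continuous_on {a..b} h \<Longrightarrow> set_integrable M (S x) h"
  by (rule set_integrable_continuous_on_compact[OF finite_measure_axioms sets_M compact_section])
     (erule continuous_on_subset, auto simp: support_section_def)

lemma integrable_domain:
  fixes h :: "real \<Rightarrow> real"
  shows "continuous_on {a..b} h \<Longrightarrow> set_integrable M {a..b} h"
  by (rule set_integrable_continuous_on_compact[OF finite_measure_axioms sets_M compact_Icc])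

text \<open>
  The integrand of the constraint vanishes off the section, so a null section would force
  \<open>\<epsilon> = 0\<close>.
\<close>
lemma measure_section_pos:
  assumes "x \<in> X"
  shows "0 < measure M (S x)"
proof (rule ccontr)
  assume "\<not> ?thesis"
  then have "S x \<in> null_sets M"
    using section_sets by (auto simp: emeasure_eq_measure null_sets_def not_less measure_le_0_iff)
  then have "AE y in M. y \<notin> S x"
    by (rule AE_not_in)
  then have "AE y in M. indicator {a..b} y *\<^sub>R max (x * y - f x - g y) 0 = 0"
    by eventually_elim (auto simp: support_section_def indicator_def max_def)
  then have "(LINT y:{a..b}|M. max (x * y - f x - g y) 0) = 0"
    unfolding set_lebesgue_integral_def by (rule integral_eq_zero_AE)
  then show False using section_integral[OF assms] eps_pos by simp
qed

text \<open>
  Pointwise in \<open>y\<close>, the indicator of the section is a subgradient of the positive part at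
  \<open>x * y - f x - g y\<close>. In the integrated inequality the two constraint integrals cancel.
\<close>
lemma subgradient:
  assumes "x \<in> X" "x' \<in> X"
  shows "f x + section_mean x * (x' - x) \<le> f x'"
proof -
  let ?p = "\<lambda>x y. x * y - f x - g y"
  have cont: "continuous_on {a..b} (\<lambda>y. max (?p x y) 0)" for x
    by (intro continuous_intros cont_g)
  have "(LINT y:S x|M. (x' - x) * y - (f x' - f x))
      \<le> (LINT y:{a..b}|M. max (?p x' y) 0 - max (?p x y) 0)"
    unfolding set_lebesgue_integral_def
  proof (rule integral_mono)
    show "integrable M (\<lambda>y. indicator (S x) y *\<^sub>R ((x' - x) * y - (f x' - f x)))"
      using integrable_section[of "\<lambda>y. (x' - x) * y - (f x' - f x)"]
      by (simp add: set_integrable_def continuous_intros)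
    show "integrable M (\<lambda>y. indicator {a..b} y *\<^sub>R (max (?p x' y) 0 - max (?p x y) 0))"
      using integrable_domain[OF continuous_on_diff[OF cont cont]]
      by (simp add: set_integrable_def)
  qed (auto simp: indicator_def support_section_def algebra_simps)
  also have "\<dots> = 0"
    using section_integral assms by (simp add: set_integral_diff integrable_domain[OF cont])
  finally have "(LINT y:S x|M. (x' - x) * y) - (LINT y:S x|M. f x' - f x) \<le> 0"
    by (subst (asm) set_integral_diff) (auto intro!: integrable_section continuous_intros)
  then have "(x' - x) * (LINT y:S x|M. y) \<le> (f x' - f x) * measure M (S x)"
    by (simp add: set_lebesgue_integral_def mult.commute)
  then show ?thesis
    using measure_section_pos[OF assms(1)] by (simp add: section_mean_def field_simps)
qed

text \<open>
  The affine minorant at \<open>z = (1 - t) x + t y\<close> touches \<open>f\<close> at \<open>z\<close> and lies below \<open>f\<close> at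
  \<open>x\<close> and \<open>y\<close>.
\<close>
lemma convex_on_potential: "convex_on X f"
proof
  fix t x y :: real
  assume t: "0 < t" "t < 1" and xy: "x \<in> X" "y \<in> X"
  define z where "z = (1 - t) *\<^sub>R x + t *\<^sub>R y"
  have "z \<in> X" using convexD[OF convex_X xy, of "1 - t" t] t by (simp add: z_def)
  have "f z = (1 - t) * (f z + section_mean z * (x - z)) + t * (f z + section_mean z * (y - z))"
    by (simp add: z_def algebra_simps)
  also have "\<dots> \<le> (1 - t) * f x + t * f y"
    using t subgradient[OF \<open>z \<in> X\<close>] xy by (intro add_mono mult_left_mono) auto
  finally show "f ((1 - t) *\<^sub>R x + t *\<^sub>R y) \<le> (1 - t) * f x + t * f y"
    by (simp add: z_def)
qed (fact convex_X)

end

section \<open>Sections of a convex potential\<close>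

text \<open>
  Convexity of \<open>g\<close> is itself an instance of \<open>convex_on_potential\<close>, for the constraint of the
  other marginal.
\<close>
locale convex_section_equation = section_equation +
  assumes convex_g: "convex_on {a..b} g"
    and cont_f: "continuous_on X f"
    and null_singleton: "\<And>y. measure M {y} = 0"
begin

lemma AE_neq: "AE y in M. y \<noteq> c"
proof -
  have "{c} \<in> null_sets M"
    using null_singleton[of c] by (auto simp: null_sets_def emeasure_eq_measure sets_M)
  from AE_not_in[OF this] show ?thesis by simp
qed

text \<open>
  The function \<open>y \<mapsto> x * y - f x - g y\<close> is concave, and it is positive at some \<open>z\<close> because
  its positive part integrates to \<open>\<epsilon>\<close>. Every interior point of the section lies between
  \<open>z\<close> and an endpoint, so concavity carries positivity over to it. In particular the zero
  set is contained in the two endpoints.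
\<close>
lemma section_interval:
  assumes "x \<in> X"
  obtains c d where "S x = {c..d}" "c < d" 
    "\<And>y. c < y \<Longrightarrow> y < d \<Longrightarrow> 0 < x * y - f x - g y"
proof -
  let ?p = "\<lambda>y. x * y - f x - g y"
  have concave: "(1 - t) * ?p y + t * ?p y' \<le> ?p ((1 - t) * y + t * y')"
    if "y \<in> {a..b}" "y' \<in> {a..b}" "0 \<le> t" "t \<le> 1" for y y' t
    using convex_onD[OF convex_g that(3,4,1,2)] by (simp add: algebra_simps)
  have dom: "(1 - t) * y + t * y' \<in> {a..b}"
    if "y \<in> {a..b}" "y' \<in> {a..b}" "0 \<le> t" "t \<le> 1" for y y' t
    using convexD_alt[of "{a..b}" y y' t] that by auto
  have "convex (S x)"
    unfolding convex_alt
  proof (intro ballI allI impI)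
    fix y y' t :: real
    assume "y \<in> S x" "y' \<in> S x" and t: "0 \<le> t \<and> t \<le> 1"
    then have y: "y \<in> {a..b}" "0 \<le> ?p y" "y' \<in> {a..b}" "0 \<le> ?p y'"
      by (auto simp: support_section_def)
    then have "0 \<le> (1 - t) * ?p y + t * ?p y'"
      using t by (intro add_nonneg_nonneg mult_nonneg_nonneg) auto
    also have "\<dots> \<le> ?p ((1 - t) * y + t * y')"
      using concave[of y y' t] t y by simp
    finally show "(1 - t) *\<^sub>R y + t *\<^sub>R y' \<in> S x"
      using dom[of y y' t] t y by (simp add: support_section_def)
  qed
  then obtain c d where cd: "S x = {c..d}"
    using compact_section[of x] connected_compact_interval_1 convex_connected by metis
  have mem: "y \<in> {c..d} \<longleftrightarrow> y \<in> {a..b} \<and> 0 \<le> ?p y" for y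
    unfolding cd[symmetric] by (simp add: support_section_def)
  have "c < d"
  proof (rule ccontr)
    assume "\<not> c < d"
    then have "S x \<subseteq> {c}" using cd by auto
    then have "measure M (S x) \<le> measure M {c}"
      by (intro finite_measure_mono) (auto simp: sets_M)
    then show False using measure_section_pos[OF assms] null_singleton[of c] by simp
  qed
  moreover have "0 < ?p y" if "c < y" "y < d" for y
  proof -
    have sub: "c \<in> {a..b}" "d \<in> {a..b}" "0 \<le> ?p c" "0 \<le> ?p d"
      using mem[of c] mem[of d] \<open>c < d\<close> by auto
    have "\<exists>z\<in>{a..b}. 0 < ?p z"
    proof (rule ccontr)
      assume "\<not> ?thesis"
      then have "(LINT y:{a..b}|M. max (?p y) 0) = (LINT y:{a..b}|M. 0)"
        by (intro set_lebesgue_integral_cong) (auto simp: sets_M not_less max_def)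
      then show False using section_integral[OF assms] eps_pos by simp
    qed
    then obtain z where z: "z \<in> {a..b}" "0 < ?p z" by blast
    then have "z \<in> {c..d}" using mem[of z] by simp
    \<comment> \<open>Concavity on the segment from \<open>z\<close> to an endpoint \<open>e\<close>.\<close>
    have *: "0 < ?p y" if e: "e \<in> {a..b}" "0 \<le> ?p e"
      and seg: "(z < y \<and> y < e) \<or> (e < y \<and> y < z)" for e
    proof -
      define t where "t = (y - z) / (e - z)"
      have "e \<noteq> z" using seg by auto
      have t: "0 < t" "t < 1" using seg by (auto simp: t_def field_simps)
      have "t * (e - z) = y - z" using \<open>e \<noteq> z\<close> by (simp add: t_def)
      then have yt: "(1 - t) * z + t * e = y" by (simp add: algebra_simps)
      have "0 < (1 - t) * ?p z + t * ?p e"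
        using t z e by (intro add_pos_nonneg mult_pos_pos mult_nonneg_nonneg) auto
      also have "\<dots> \<le> ?p y" using concave[of z e t] t z e yt by simp
      finally show ?thesis .
    qed
    show ?thesis
      using *[OF sub(1,3)] *[OF sub(2,4)] \<open>z \<in> {c..d}\<close> that z(2)
      by (cases y z rule: linorder_cases) auto
  qed
  ultimately show thesis using that cd by blast
qed

text \<open>
  For the section \<open>{c..d}\<close>, the functions \<open>y - c\<close> and \<open>d - y\<close> are nonnegative with a single
  zero, which is a null set. Their integrals are therefore strictly positive.
\<close>
lemma section_mean_in_interior:
  assumes "x \<in> X"
  shows "section_mean x \<in> interior (S x)"
proof -
  obtain c d where cd: "S x = {c..d}" "c < d"
    using section_interval[OF assms] by metis
  have pos: "0 < measure M {c..d}" using measure_section_pos[OF assms] cd by simp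
  have strict: "0 < (LINT y:{c..d}|M. h y)"
    if h: "continuous_on {c..d} h" "\<And>y. y \<in> {c..d} \<Longrightarrow> 0 \<le> h y"
      "\<And>y. y \<in> {c..d} \<Longrightarrow> h y = 0 \<Longrightarrow> y = e" for h :: "real \<Rightarrow> real" and e
  proof (rule ccontr)
    have int: "integrable M (\<lambda>y. indicator {c..d} y *\<^sub>R h y)"
      using set_integrable_continuous_on_compact[OF finite_measure_axioms sets_M compact_Icc h(1)]
      by (simp add: set_integrable_def)
    have nonneg: "AE y in M. 0 \<le> indicator {c..d} y *\<^sub>R h y"
      using h(2) by (auto simp: indicator_def)
    assume "\<not> ?thesis"
    then have "(LINT y|M. indicator {c..d} y *\<^sub>R h y) = 0"
      using integral_nonneg_AE[OF nonneg] by (simp add: set_lebesgue_integral_def)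
    then have "AE y in M. indicator {c..d} y *\<^sub>R h y = 0"
      using integral_nonneg_eq_0_iff_AE[OF int nonneg] by simp
    then have "AE y in M. y \<notin> {c..d}"
      using AE_neq[of e] by eventually_elim (use h(3) in \<open>auto simp: indicator_def\<close>)
    then have "measure M {c..d} = 0"
      by (subst (asm) AE_iff_null_sets[symmetric]) (auto simp: sets_M measure_eq_0_null_sets)
    then show False using pos by simp
  qed
  have int: "set_integrable M {c..d} h" if "continuous_on {c..d} h" for h :: "real \<Rightarrow> real"
    using set_integrable_continuous_on_compact[OF finite_measure_axioms sets_M compact_Icc that] .
  have const: "(LINT y:{c..d}|M. k) = k * measure M {c..d}" for k :: real
    by (simp add: set_lebesgue_integral_def)
  have "0 < (LINT y:{c..d}|M. y - c)"
    by (rule strict[of _ c]) (auto intro!: continuous_intros)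
  moreover have "0 < (LINT y:{c..d}|M. d - y)"
    by (rule strict[of _ d]) (auto intro!: continuous_intros)
  ultimately have "c * measure M {c..d} < (LINT y:{c..d}|M. y)"
    "(LINT y:{c..d}|M. y) < d * measure M {c..d}"
    by (simp_all add: set_integral_diff int const)
  then show ?thesis using pos by (simp add: section_mean_def cd field_simps)
qed

text \<open>
  If \<open>x * y - f x - g y\<close> is not zero, then its sign persists for parameters close to \<open>x\<close>,
  so the indicator of the section at \<open>y\<close> is locally constant in \<open>x\<close>. The exceptional \<open>y\<close>
  are endpoints of the section at \<open>x\<close> and form a null set.
\<close>
lemma continuous_on_section_integral:
  fixes h :: "real \<Rightarrow> real"
  assumes "continuous_on {a..b} h"
  shows "continuous_on X (\<lambda>x. LINT y:S x|M. h y)"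
  unfolding continuous_on_eq_continuous_within
proof (intro ballI continuous_within_sequentiallyI)
  fix x and u :: "nat \<Rightarrow> real"
  assume x: "x \<in> X" and u: "u \<longlonglongrightarrow> x" "\<forall>n. u n \<in> X"
  obtain c d where cd: "S x = {c..d}"
    "\<And>y. c < y \<Longrightarrow> y < d \<Longrightarrow> 0 < x * y - f x - g y"
    using section_interval[OF x] by metis
  have fu: "(\<lambda>n. f (u n)) \<longlonglongrightarrow> f x"
    using continuous_on_tendsto_compose[OF cont_f u(1) x] u(2) by simp
  show "(\<lambda>n. LINT y:S (u n)|M. h y) \<longlonglongrightarrow> (LINT y:S x|M. h y)"
    unfolding set_lebesgue_integral_def
  proof (rule integral_dominated_convergence)
    show "integrable M (\<lambda>y. norm (indicator {a..b} y *\<^sub>R h y))"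
      using integrable_domain[OF assms] unfolding set_integrable_def by (rule integrable_norm)
    show "(\<lambda>y. indicator (S x) y *\<^sub>R h y) \<in> borel_measurable M"
      "\<And>n. (\<lambda>y. indicator (S (u n)) y *\<^sub>R h y) \<in> borel_measurable M"
      using integrable_section[OF assms] by (simp_all add: set_integrable_def borel_measurable_integrable)
    show "AE y in M. norm (indicator (S (u n)) y *\<^sub>R h y)
        \<le> norm (indicator {a..b} y *\<^sub>R h y)" for n
      by (auto simp: indicator_def support_section_def)
    show "AE y in M. (\<lambda>n. indicator (S (u n)) y *\<^sub>R h y) \<longlonglongrightarrow> indicator (S x) y *\<^sub>R h y"
      using AE_neq[of c] AE_neq[of d]
    proof eventually_elim
      case (elim y)
      let ?p = "\<lambda>x. x * y - f x - g y"
      have lim: "(\<lambda>n. ?p (u n)) \<longlonglongrightarrow> ?p x"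
        by (intro tendsto_intros u fu)
      have "\<forall>\<^sub>F n in sequentially. indicator (S (u n)) y *\<^sub>R h y = indicator (S x) y *\<^sub>R h y"
      proof (cases "y \<in> {a..b}")
        case True
        consider "0 < ?p x" | "?p x < 0"
        proof (cases "y \<in> S x")
          case True
          then have "0 < ?p x" using elim cd by auto
          then show thesis by (rule that(1))
        next
          case False
          then have "?p x < 0" using \<open>y \<in> {a..b}\<close> by (simp add: support_section_def)
          then show thesis by (rule that(2))
        qed
        then show ?thesis
        proof cases
          case 1
          from order_tendstoD(1)[OF lim 1] show ?thesis
            by eventually_elim (use 1 True in \<open>auto simp: support_section_def indicator_def\<close>)
        next
          case 2
          from order_tendstoD(2)[OF lim 2] show ?thesis
            by eventually_elim (use 2 True in \<open>auto simp: support_section_def indicator_def\<close>)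
        qed
      next
        case False
        then show ?thesis by (auto simp: support_section_def indicator_def)
      qed
      then show ?case by (rule tendsto_eventually)
    qed
  qed
qed

lemma continuous_on_section_mean: "continuous_on X section_mean"
proof -
  have "continuous_on X (\<lambda>x. measure M (S x))"
    using continuous_on_section_integral[of "\<lambda>_. 1"] by (simp add: set_lebesgue_integral_def)
  then show ?thesis
    unfolding section_mean_def[abs_def]
    using measure_section_pos
    by (intro continuous_on_divide continuous_on_section_integral continuous_intros) force+
qed

text \<open>
  The subgradient inequalities at \<open>x\<close> and at \<open>x'\<close> place the difference quotient between the
  section means at \<open>x\<close> and \<open>x'\<close>.
\<close>
lemma potential_has_derivative:
  assumes "x \<in> X"
  shows "(f has_real_derivative section_mean x) (at x within X)"
  unfolding has_field_derivative_iff
proof (rule LIM_zero_cancel, rule Lim_null_comparison)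
  show "((\<lambda>x'. \<bar>section_mean x' - section_mean x\<bar>) \<longlongrightarrow> 0) (at x within X)"
    using continuous_on_section_mean assms
    by (auto simp: continuous_on_def intro!: tendsto_rabs_zero LIM_zero)
  show "\<forall>\<^sub>F x' in at x within X.
      norm ((f x' - f x) / (x' - x) - section_mean x) \<le> \<bar>section_mean x' - section_mean x\<bar>"
    unfolding eventually_at_filter
  proof (intro always_eventually allI impI)
    fix x' assume x': "x' \<noteq> x" "x' \<in> X"
    have *: "section_mean x * (x' - x) \<le> f x' - f x" "f x' - f x \<le> section_mean x' * (x' - x)"
      using subgradient[OF assms x'(2)] subgradient[OF x'(2) assms] by (auto simp: algebra_simps)
    show "norm ((f x' - f x) / (x' - x) - section_mean x) \<le> \<bar>section_mean x' - section_mean x\<bar>"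
    proof (cases "x < x'")
      case True
      then have "section_mean x \<le> (f x' - f x) / (x' - x)" "(f x' - f x) / (x' - x) \<le> section_mean x'"
        using * by (auto simp: pos_le_divide_eq pos_divide_le_eq)
      then show ?thesis by auto
    next
      case False
      then have "x' - x < 0" using x' by auto
      then have "(f x' - f x) / (x' - x) \<le> section_mean x" "section_mean x' \<le> (f x' - f x) / (x' - x)"
        using * by (auto simp: neg_le_divide_eq neg_divide_le_eq)
      then show ?thesis by auto
    qed
  qed
qed

end

section \<open>The marginal constraints in integral form\<close>

text \<open>
  By Tonelli, the first marginal of the plan with density \<open>H\<close> has density
  \<open>x \<mapsto> \<integral>\<^sup>+y. H (x, y) \<partial>N\<close> with respect to \<open>M\<close>. If this marginal is \<open>M\<close>, uniqueness of
  densities makes the inner integral one.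
\<close>
lemma fst_marginal_density:
  assumes "prob_space M" "prob_space N"
    and H [measurable]: "H \<in> borel_measurable (M \<Otimes>\<^sub>M N)"
    and marg: "distr (density (M \<Otimes>\<^sub>M N) H) M fst = M"
  shows "AE x in M. (\<integral>\<^sup>+y. H (x, y) \<partial>N) = 1"
proof -
  interpret M: prob_space M by fact
  interpret N: prob_space N by fact
  have "density M (\<lambda>x. \<integral>\<^sup>+y. H (x, y) \<partial>N) = density M (\<lambda>_. 1)"
  proof (rule measure_eqI)
    fix A assume "A \<in> sets (density M (\<lambda>x. \<integral>\<^sup>+y. H (x, y) \<partial>N))"
    then have A [measurable]: "A \<in> sets M" by simp
    have "emeasure (density M (\<lambda>x. \<integral>\<^sup>+y. H (x, y) \<partial>N)) A
        = (\<integral>\<^sup>+x. \<integral>\<^sup>+y. H (x, y) * indicator A x \<partial>N \<partial>M)"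
      by (auto simp: emeasure_density nn_integral_multc intro!: nn_integral_cong)
    also have "\<dots> = (\<integral>\<^sup>+z. H z * indicator A (fst z) \<partial>(M \<Otimes>\<^sub>M N))"
      by (subst N.nn_integral_fst[symmetric]) simp_all
    also have "\<dots> = (\<integral>\<^sup>+z. H z * indicator (fst -` A \<inter> space (M \<Otimes>\<^sub>M N)) z \<partial>(M \<Otimes>\<^sub>M N))"
      by (intro nn_integral_cong) (auto simp: indicator_def)
    also have "\<dots> = emeasure (distr (density (M \<Otimes>\<^sub>M N) H) M fst) A"
      by (simp add: emeasure_distr emeasure_density)
    finally show "emeasure (density M (\<lambda>x. \<integral>\<^sup>+y. H (x, y) \<partial>N)) A = emeasure (density M (\<lambda>_. 1)) A"
      by (simp add: marg density_1)
  qed simp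
  then show ?thesis by (intro M.density_unique) auto
qed

lemma snd_marginal_density:
  assumes "prob_space M" "prob_space N"
    and H [measurable]: "H \<in> borel_measurable (M \<Otimes>\<^sub>M N)"
    and marg: "distr (density (M \<Otimes>\<^sub>M N) H) N snd = N"
  shows "AE y in N. (\<integral>\<^sup>+x. H (x, y) \<partial>M) = 1"
proof -
  interpret M: prob_space M by fact
  interpret N: prob_space N by fact
  interpret pair_sigma_finite M N ..
  let ?H = "\<lambda>(y, x). H (x, y)"
  have "density (M \<Otimes>\<^sub>M N) H
      = density (distr (N \<Otimes>\<^sub>M M) (M \<Otimes>\<^sub>M N) (\<lambda>(x, y). (y, x))) H"
    by (simp flip: distr_pair_swap)
  also have "\<dots> = distr (density (N \<Otimes>\<^sub>M M) ?H) (M \<Otimes>\<^sub>M N) (\<lambda>(x, y). (y, x))"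
    by (subst density_distr) (auto simp: split_beta')
  finally have "distr (density (N \<Otimes>\<^sub>M M) ?H) N fst = N"
    using marg by (simp add: distr_distr comp_def split_beta)
  from fst_marginal_density[OF assms(2,1) _ this] show ?thesis by simp
qed

text \<open>
  The density is positive exactly on \<open>{a..b}\<close>, so \<open>\<mu>\<close> has the same null sets as Lebesgue
  measure restricted to that interval.
\<close>
lemma regular_marginalD:
  assumes "regular_marginal \<mu> a b u l L"
  shows "prob_space \<mu>" "sets \<mu> = sets borel" "AE x in \<mu>. x \<in> {a..b}" "measure \<mu> {y} = 0"
    "(AE x in \<mu>. P x) \<Longrightarrow> AE x\<in>{a..b} in lebesgue. P x" "a < b"
proof -
  have \<mu>: "\<mu> = density lborel (\<lambda>x. ennreal (indicator {a..b} x * u x))"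
    and cont: "continuous_on {a..b} u" and "0 < l" and u: "\<forall>x\<in>{a..b}. l \<le> u x \<and> u x \<le> L"
    using assms unfolding regular_marginal_def by blast+
  show "prob_space \<mu>" using assms unfolding regular_marginal_def by blast
  then interpret prob_space \<mu> .
  show sets: "sets \<mu> = sets borel" by (subst \<mu>) simp
  have meas: "(\<lambda>x. ennreal (indicator {a..b} x * u x)) \<in> borel_measurable lborel"
    using borel_measurable_continuous_on_indicator[OF _ cont] by simp
  have AE: "(AE x in \<mu>. P x) \<longleftrightarrow> (AE x in lborel. x \<in> {a..b} \<longrightarrow> P x)" for P
  proof -
    have "0 < u x" if "x \<in> {a..b}" for x
      using u \<open>0 < l\<close> that by force
    then have "(0 < ennreal (indicator {a..b} x * u x)) \<longleftrightarrow> x \<in> {a..b}" for x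
      by (auto simp: indicator_def ennreal_less_zero_iff)
    then show ?thesis by (subst \<mu>) (simp add: AE_density[OF meas])
  qed
  show "AE x in \<mu>. x \<in> {a..b}" by (simp add: AE)
  show "AE x\<in>{a..b} in lebesgue. P x" if "AE x in \<mu>. P x"
    using that unfolding AE by (rule AE_completion)
  have neq: "AE x in \<mu>. x \<noteq> y" for y
    unfolding AE using AE_lborel_singleton[of y] by eventually_elim simp
  then show "measure \<mu> {y} = 0"
    using AE_iff_null_sets[of "{y}" \<mu>] by (simp add: measure_eq_0_null_sets sets)
  show "a < b"
  proof (rule ccontr)
    assume "\<not> a < b"
    have "AE x in \<mu>. False"
      using \<open>AE x in \<mu>. x \<in> {a..b}\<close> neq[of a] by eventually_elim (use \<open>\<not> a < b\<close> in auto)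
    then show False by simp
  qed
qed

text \<open>
  The section integral is continuous in \<open>x\<close>, so it equals \<open>\<epsilon>\<close> on a closed set. A closed set
  of full Lebesgue measure in an open interval contains that interval, and then also its
  endpoints.
\<close>
lemma AE_section_integral_imp_all:
  fixes f g :: "real \<Rightarrow> real"
  assumes \<mu>: "regular_marginal \<mu> a b u l L" and \<nu>: "regular_marginal \<nu> c d v l' L'"
    and f: "continuous_on {a..b} f" and g: "continuous_on {c..d} g" and "0 < \<epsilon>"
    and AE: "AE x in \<mu>. (\<integral>\<^sup>+y. ennreal (indicator {c..d} y * max ((x * y - f x - g y) / \<epsilon>) 0) \<partial>\<nu>) = 1"
    and "x \<in> {a..b}"
  shows "(LINT y:{c..d}|\<nu>. max (x * y - f x - g y) 0) = \<epsilon>"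
proof -
  interpret \<nu>: prob_space \<nu> using regular_marginalD(1)[OF \<nu>] .
  note sets = regular_marginalD(2)[OF \<nu>]
  let ?p = "\<lambda>x y. max (x * y - f x - g y) 0"
  let ?F = "\<lambda>x. LINT y:{c..d}|\<nu>. ?p x y"
  have int: "set_integrable \<nu> {c..d} (?p x)" for x
    by (intro set_integrable_continuous_on_compact \<nu>.finite_measure_axioms sets)
       (auto intro!: continuous_intros g)
  have eq: "?F x = \<epsilon>"
    if "(\<integral>\<^sup>+y. ennreal (indicator {c..d} y * max ((x * y - f x - g y) / \<epsilon>) 0) \<partial>\<nu>) = 1" for x
  proof -
    have "max ((x * y - f x - g y) / \<epsilon>) 0 = ?p x y / \<epsilon>" for y
      using \<open>0 < \<epsilon>\<close> by (auto simp: max_def field_simps)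
    then have "(\<integral>\<^sup>+y. ennreal (indicator {c..d} y *\<^sub>R ?p x y / \<epsilon>) \<partial>\<nu>) = 1"
      using that by simp
    moreover have "(\<integral>\<^sup>+y. ennreal (indicator {c..d} y *\<^sub>R ?p x y / \<epsilon>) \<partial>\<nu>) = ennreal (?F x / \<epsilon>)"
      unfolding set_lebesgue_integral_def
      using int[of x] \<open>0 < \<epsilon>\<close>
      by (subst nn_integral_eq_integral) (auto simp: set_integrable_def)
    ultimately show ?thesis using \<open>0 < \<epsilon>\<close> by (simp add: field_simps)
  qed
  have cont: "continuous_on {a..b} ?F"
    unfolding continuous_on_eq_continuous_within
  proof (intro ballI continuous_within_sequentiallyI)
    fix x and w :: "nat \<Rightarrow> real"
    assume x: "x \<in> {a..b}" and w: "w \<longlonglongrightarrow> x" "\<forall>n. w n \<in> {a..b}"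
    have fw: "(\<lambda>n. f (w n)) \<longlonglongrightarrow> f x"
      using continuous_on_tendsto_compose[OF f w(1) x] w(2) by simp
    have "bounded (f ` {a..b})"
      by (intro compact_imp_bounded compact_continuous_image f) simp
    then obtain B where B: "\<And>z. z \<in> {a..b} \<Longrightarrow> \<bar>f z\<bar> \<le> B"
      unfolding bounded_iff real_norm_def by blast
    let ?C = "max \<bar>a\<bar> \<bar>b\<bar>"
    show "(\<lambda>n. ?F (w n)) \<longlonglongrightarrow> ?F x"
      unfolding set_lebesgue_integral_def
    proof (rule integral_dominated_convergence)
      show "(\<lambda>y. indicator {c..d} y *\<^sub>R ?p x y) \<in> borel_measurable \<nu>"
        "\<And>n. (\<lambda>y. indicator {c..d} y *\<^sub>R ?p (w n) y) \<in> borel_measurable \<nu>"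
        using int by (simp_all add: set_integrable_def borel_measurable_integrable)
      show "integrable \<nu> (\<lambda>y. indicator {c..d} y *\<^sub>R (?C * \<bar>y\<bar> + B + \<bar>g y\<bar>))"
        unfolding set_integrable_def[symmetric]
        by (intro set_integrable_continuous_on_compact \<nu>.finite_measure_axioms sets)
           (auto intro!: continuous_intros g)
      show "AE y in \<nu>. norm (indicator {c..d} y *\<^sub>R ?p (w n) y)
          \<le> indicator {c..d} y *\<^sub>R (?C * \<bar>y\<bar> + B + \<bar>g y\<bar>)" for n
      proof (intro always_eventually allI)
        fix y
        have "\<bar>w n\<bar> \<le> ?C" using w(2)[rule_format, of n] by auto
        then have "\<bar>w n * y\<bar> \<le> ?C * \<bar>y\<bar>" by (simp add: abs_mult mult_right_mono)
        moreover have "\<bar>f (w n)\<bar> \<le> B" using B w(2) by blast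
        ultimately have "?p (w n) y \<le> ?C * \<bar>y\<bar> + B + \<bar>g y\<bar>" by linarith
        then show "norm (indicator {c..d} y *\<^sub>R ?p (w n) y)
          \<le> indicator {c..d} y *\<^sub>R (?C * \<bar>y\<bar> + B + \<bar>g y\<bar>)"
          by (simp add: indicator_def)
      qed
      show "AE y in \<nu>. (\<lambda>n. indicator {c..d} y *\<^sub>R ?p (w n) y) \<longlonglongrightarrow> indicator {c..d} y *\<^sub>R ?p x y"
        by (intro always_eventually allI tendsto_intros w fw)
    qed
  qed
  let ?E = "{x \<in> {a..b}. ?F x = \<epsilon>}"
  have closed: "closed ?E"
    using continuous_closed_preimage[OF cont, of "{\<epsilon>}"]
    by (simp add: vimage_def Int_def conj_commute)
  have "AE x\<in>{a..b} in lebesgue. ?F x = \<epsilon>"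
    using AE eq by (intro regular_marginalD(5)[OF \<mu>]) auto
  then have "AE x\<in>{a<..<b} in lebesgue. x \<in> ?E" by eventually_elim auto
  then have "{a<..<b} \<subseteq> ?E"
    by (intro subsetI mem_closed_if_AE_lebesgue_open[OF open_greaterThanLessThan closed])
  then have "closure {a<..<b} \<subseteq> ?E" using closed by (rule closure_minimal)
  then show ?thesis using \<open>x \<in> {a..b}\<close> regular_marginalD(6)[OF \<mu>] by auto
qed

lemma potentials_section_equations:
  assumes \<mu>0: "regular_marginal \<mu>0 a0 b0 u0 l L" and \<mu>1: "regular_marginal \<mu>1 a1 b1 u1 l L"
    and "0 < \<epsilon>" and \<pi>: "\<pi> \<in> couplings \<mu>0 \<mu>1"
    and pot: "qot_potentials \<mu>0 \<mu>1 {a0..b0} {a1..b1} \<epsilon> \<pi> f g"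
  shows "\<And>x. x \<in> {a0..b0} \<Longrightarrow> (LINT y:{a1..b1}|\<mu>1. max (x * y - f x - g y) 0) = \<epsilon>"
    and "\<And>y. y \<in> {a1..b1} \<Longrightarrow> (LINT x:{a0..b0}|\<mu>0. max (y * x - g y - f x) 0) = \<epsilon>"
proof -
  interpret M: prob_space \<mu>0 using regular_marginalD(1)[OF \<mu>0] .
  interpret N: prob_space \<mu>1 using regular_marginalD(1)[OF \<mu>1] .
  interpret P: pair_prob_space \<mu>0 \<mu>1 ..
  note sets0 [measurable_cong] = regular_marginalD(2)[OF \<mu>0]
  note sets1 [measurable_cong] = regular_marginalD(2)[OF \<mu>1]
  note in0 = regular_marginalD(3)[OF \<mu>0] and in1 = regular_marginalD(3)[OF \<mu>1]
  have f: "continuous_on {a0..b0} f" and g: "continuous_on {a1..b1} g"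
    and ac: "absolutely_continuous (\<mu>0 \<Otimes>\<^sub>M \<mu>1) \<pi>"
    and RN: "AE z in \<mu>0 \<Otimes>\<^sub>M \<mu>1. RN_deriv (\<mu>0 \<Otimes>\<^sub>M \<mu>1) \<pi> z
        = ennreal (max ((fst z * snd z - f (fst z) - g (snd z)) / \<epsilon>) 0)"
    using pot by (auto simp: qot_potentials_def split_beta)
  have sets: "sets \<pi> = sets (\<mu>0 \<Otimes>\<^sub>M \<mu>1)" and m0: "distr \<pi> \<mu>0 fst = \<mu>0" and m1: "distr \<pi> \<mu>1 snd = \<mu>1"
    using \<pi> by (auto simp: couplings_def)
  \<comment> \<open>Nothing is known about the potentials off the intervals; cutting them off there gives a
    Borel version of the density.\<close>
  define f' where "f' x = indicator {a0..b0} x *\<^sub>R f x" for x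
  define g' where "g' y = indicator {a1..b1} y *\<^sub>R g y" for y
  have [measurable]: "f' \<in> borel_measurable borel" "g' \<in> borel_measurable borel"
    unfolding f'_def g'_def
    using f g by (simp_all only: borel_measurable_continuous_on_indicator atLeastAtMost_borel)
  define H where "H z = ennreal (indicator {a0..b0} (fst z) * indicator {a1..b1} (snd z)
      * max ((fst z * snd z - f' (fst z) - g' (snd z)) / \<epsilon>) 0)" for z
  have H [measurable]: "H \<in> borel_measurable (\<mu>0 \<Otimes>\<^sub>M \<mu>1)"
    unfolding H_def by measurable
  have "AE z in \<mu>0 \<Otimes>\<^sub>M \<mu>1. fst z \<in> {a0..b0}"
    by (rule P.AE_pair_measure) (use in0 in \<open>simp_all del: atLeastAtMost_iff\<close>)
  moreover have "AE z in \<mu>0 \<Otimes>\<^sub>M \<mu>1. snd z \<in> {a1..b1}"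
    by (rule P.AE_pair_measure) (use in1 in \<open>simp_all del: atLeastAtMost_iff\<close>)
  ultimately have "AE z in \<mu>0 \<Otimes>\<^sub>M \<mu>1. RN_deriv (\<mu>0 \<Otimes>\<^sub>M \<mu>1) \<pi> z = H z"
    using RN by eventually_elim (simp add: H_def f'_def g'_def)
  then have "density (\<mu>0 \<Otimes>\<^sub>M \<mu>1) (RN_deriv (\<mu>0 \<Otimes>\<^sub>M \<mu>1) \<pi>) = density (\<mu>0 \<Otimes>\<^sub>M \<mu>1) H"
    by (intro density_cong) auto
  then have dens: "\<pi> = density (\<mu>0 \<Otimes>\<^sub>M \<mu>1) H"
    using P.density_RN_deriv[OF ac sets] by simp
  have "AE x in \<mu>0. (\<integral>\<^sup>+y. H (x, y) \<partial>\<mu>1) = 1"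
    using m0 by (intro fst_marginal_density M.prob_space_axioms N.prob_space_axioms H) (simp flip: dens)
  then have "AE x in \<mu>0. (\<integral>\<^sup>+y. ennreal (indicator {a1..b1} y * max ((x * y - f x - g y) / \<epsilon>) 0) \<partial>\<mu>1) = 1"
    using in0
  proof eventually_elim
    case (elim x)
    have "H (x, y) = ennreal (indicator {a1..b1} y * max ((x * y - f x - g y) / \<epsilon>) 0)" for y
      using elim(2) by (simp add: H_def f'_def g'_def indicator_def)
    then show ?case using elim(1) by simp
  qed
  from AE_section_integral_imp_all[OF \<mu>0 \<mu>1 f g \<open>0 < \<epsilon>\<close> this]
  show "(LINT y:{a1..b1}|\<mu>1. max (x * y - f x - g y) 0) = \<epsilon>" if "x \<in> {a0..b0}" for x
    using that .
  have "AE y in \<mu>1. (\<integral>\<^sup>+x. H (x, y) \<partial>\<mu>0) = 1"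
    using m1 by (intro snd_marginal_density M.prob_space_axioms N.prob_space_axioms H) (simp flip: dens)
  then have "AE y in \<mu>1. (\<integral>\<^sup>+x. ennreal (indicator {a0..b0} x * max ((y * x - g y - f x) / \<epsilon>) 0) \<partial>\<mu>0) = 1"
    using in1
  proof eventually_elim
    case (elim y)
    have "H (x, y) = ennreal (indicator {a0..b0} x * max ((y * x - g y - f x) / \<epsilon>) 0)" for x
      using elim(2) by (simp add: H_def f'_def g'_def indicator_def algebra_simps)
    then show ?case using elim(1) by simp
  qed
  from AE_section_integral_imp_all[OF \<mu>1 \<mu>0 g f \<open>0 < \<epsilon>\<close> this]
  show "(LINT x:{a0..b0}|\<mu>0. max (y * x - g y - f x) 0) = \<epsilon>" if "y \<in> {a1..b1}" for y
    using that .
qed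

section \<open>Regularity of the potential\<close>

theorem proposition3p2:
  fixes \<mu>0 \<mu>1 :: "real measure" and u0 u1 :: "real \<Rightarrow> real"
    and a0 b0 a1 b1 l L \<epsilon> :: real
    and \<pi> :: "(real \<times> real) measure" and f g :: "real \<Rightarrow> real"
  assumes "regular_marginal \<mu>0 a0 b0 u0 l L"
    and "regular_marginal \<mu>1 a1 b1 u1 l L"
    and "\<epsilon> > 0"
    and "qot_minimizer \<mu>0 \<mu>1 \<epsilon> \<pi>"
    and "qot_potentials \<mu>0 \<mu>1 {a0..b0} {a1..b1} \<epsilon> \<pi> f g"
  shows "convex_on {a0..b0} f \<and>
    C1_within {a0..b0} f \<and>
    (\<forall>x\<in>{a0..b0}.
       let S = support_section {a1..b1} f g x;
           m = (LINT y:S|\<mu>1. y) / measure \<mu>1 S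
       in (f has_real_derivative m) (at x within {a0..b0}) \<and> m \<in> interior S)"
proof -
  have f: "continuous_on {a0..b0} f" and g: "continuous_on {a1..b1} g"
    using assms(5) by (auto simp: qot_potentials_def)
  have "\<pi> \<in> couplings \<mu>0 \<mu>1" using assms(4) by (simp add: qot_minimizer_def)
  note eqs = potentials_section_equations[OF assms(1-3) this assms(5)]
  interpret M: prob_space \<mu>0 using regular_marginalD(1)[OF assms(1)] .
  interpret N: prob_space \<mu>1 using regular_marginalD(1)[OF assms(2)] .
  interpret G: section_equation \<mu>0 "{a1..b1}" a0 b0 \<epsilon> g f
    by unfold_locales (use regular_marginalD(2)[OF assms(1)] f eqs(2) assms(3) in auto)
  interpret F: convex_section_equation \<mu>1 "{a0..b0}" a1 b1 \<epsilon> f g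
    by unfold_locales
      (use regular_marginalD(2,4)[OF assms(2)] f g eqs(1) assms(3) G.convex_on_potential in auto)
  have "C1_within {a0..b0} f"
    unfolding C1_within_def using F.potential_has_derivative F.continuous_on_section_mean by blast
  then show ?thesis
    using F.convex_on_potential F.potential_has_derivative F.section_mean_in_interior
    by (simp add: Let_def F.section_mean_def)
qed

end
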